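(* Let $\kappa=[2\ell]$ for some $\ell\in\mathbb Z$, let $t=F+\check E+\kappa K^{-1}$, and define for $a\ge0$ $$\dot t^{(2a)}=\frac{1}{[2a]!}\prod_{j=-a+1}^{a}\bigl(t-[2j-1]\bigr),\qquad \dot t^{(2a+1)}=\frac{t}{[2a+1]!}\prod_{j=-a+1}^{a}\bigl(t-[2j-1]\bigr).$$ (1) Let $n\in\mathbb N$. For every integer $\lambda$ sufficiently large compared to $n$, the element $\dot t^{(n)}v^+_{2\lambda+1}$ is an $\imath$-canonical basis element of $L(2\lambda+1)$. (2) The set $\{\dot t^{(n)}\mid n\in\mathbb N\}$ is the $\imath$-canonical basis of $\mathbf U^\imath$ for odd weights, and it is an $\mathcal A$-basis of ${}_{\mathcal A}\mathbf U^\imath_{\rm odd}$.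
   Context: $q$ is an indeterminate, $\mathcal A=\mathbb Z[q,q^{-1}]$, $[n]=\frac{q^n-q^{-n}}{q-q^{-1}}$, $[n]!=[1]\cdots[n]$, $[0]!=1$. $\mathbf U$ is the $\mathbb Q(q)$-algebra generated by $E,F,K^{\pm1}$ with relations $KK^{-1}=K^{-1}K=1$, $EF-FE=\frac{K-K^{-1}}{q-q^{-1}}$, $KE=q^2EK$, $KF=q^{-2}FK$; $\check E=q^{-1}EK^{-1}$, $F^{(n)}=F^n/[n]!$. $\mathbf U^\imath$ is the $\mathbb Q(q)$-subalgebra of $\mathbf U$ generated by $t$, and $\psi_\imath$ is the ring involution of $\mathbf U^\imath$ fixing $t$ and sending $q\mapsto q^{-1}$. For $\mu\in\mathbb N$, $L(\mu)$ is the simple $\mathbf U$-module of highest weight $\mu$ with highest weight vector $v^+_\mu$; it has basis $\{F^{(a)}v^+_\mu\}_{0\le a\le\mu}$ whose $\mathcal A$-span is $L(\mu)_{\mathcal A}$. The $\imath$-bar involution $\psi_\imath$ on $L(\mu)$ is the $q\mapsto q^{-1}$ semilinear map with $\psi_\imath(xv^+_\mu)=\psi_\imath(x)v^+_\mu$ for $x\in\mathbf U^\imath$. For $0\le a\le\mu$ the $\imath$-canonical basis element $b^\mu_a\in L(\mu)$ is the unique element with $\psi_\imath(b^\mu_a)=b^\mu_a$ and $b^\mu_a\in F^{(a)}v^+_\mu+\sum_{0\le r<a}q^{-1}\mathbb Z[q^{-1}]F^{(r)}v^+_\mu$ (these exist by Bao–Wang). ${}_{\mathcal A}\mathbf U^\imath_{\rm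 odd}=\{x\in\mathbf U^\imath: xv\in L(\mu)_{\mathcal A}\ \forall v\in L(\mu)_{\mathcal A},\ \forall \mu\in 2\mathbb N+1\}$. The $\imath$-canonical basis of $\mathbf U^\imath$ for odd weights (Bao–Wang) is the family $\{B_n\}_{n\in\mathbb N}\subset{}_{\mathcal A}\mathbf U^\imath_{\rm odd}$ characterized by: for each $n$, $B_nv^+_{2\lambda+1}=b^{2\lambda+1}_n$ for all $\lambda\gg0$. *)

theory Defs
  imports "HOL-Computational_Algebra.Computational_Algebra" "HOL-Computational_Algebra.Field_as_Ring"
begin

type_synonym qf = "rat poly fract"

definition qq :: qf where "qq = Fract [:0, 1:] 1"

text \<open>Bar involution on Q(q): q maps to q^-1.  For a reduced fraction a/b,
  a(q^-1)/b(q^-1) = (reflect a * q^deg b) / (reflect b * q^deg a).\<close>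
definition qbar :: "qf \<Rightarrow> qf" where
  "qbar x = (case quot_of_fract x of (a, b) \<Rightarrow>
      Fract (reflect_poly a * monom 1 (degree b)) (reflect_poly b * monom 1 (degree a)))"

definition qint :: "int \<Rightarrow> qf" where
  "qint n = (qq powi n - qq powi (- n)) / (qq - inverse qq)"

definition qfact :: "nat \<Rightarrow> qf" where
  "qfact n = (\<Prod>i = 1..n. qint (int i))"

definition in_A :: "qf \<Rightarrow> bool" where
  "in_A x \<longleftrightarrow> (\<exists>(p :: int poly) (k :: nat).
      x = Fract (map_poly of_int p) 1 * qq powi (- int k))"

definition in_qinvZ :: "qf \<Rightarrow> bool" where
  "in_qinvZ x \<longleftrightarrow> (\<exists>(p :: int poly) (d :: nat).
      degree p < d \<and> x = Fract (map_poly of_int p) (monom 1 d))"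

text \<open>Vectors of L(mu): v a is the coefficient of F^(a) v^+_mu (0 for a > mu).\<close>
type_synonym vec = "nat \<Rightarrow> qf"

definition in_L :: "nat \<Rightarrow> vec \<Rightarrow> bool" where
  "in_L \<mu> v \<longleftrightarrow> (\<forall>a. \<mu> < a \<longrightarrow> v a = 0)"

definition hwv :: vec where "hwv = (\<lambda>a. if a = 0 then 1 else 0)"

text \<open>Action of t = F + q^-1 E K^-1 + kappa K^-1 on L(mu), using
  F F^(a)v = [a+1] F^(a+1)v, E F^(a)v = [mu-a+1] F^(a-1)v, K^-1 F^(a)v = q^(2a-mu) F^(a)v.\<close>
definition t_act :: "qf \<Rightarrow> nat \<Rightarrow> vec \<Rightarrow> vec" where
  "t_act \<kappa> \<mu> v = (\<lambda>a. if a \<le> \<mu> then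
      (if a = 0 then 0 else qint (int a) * v (a - 1))
      + qq powi (2 * int a + 1 - int \<mu>) * qint (int \<mu> - int a) * v (a + 1)
      + \<kappa> * qq powi (2 * int a - int \<mu>) * v a
    else 0)"

text \<open>U^imath = Q(q)[t], elements represented as polynomials in t.\<close>
definition act :: "qf \<Rightarrow> nat \<Rightarrow> qf poly \<Rightarrow> vec \<Rightarrow> vec" where
  "act \<kappa> \<mu> x v = (\<lambda>a. \<Sum>i\<le>degree x. coeff x i * ((t_act \<kappa> \<mu> ^^ i) v) a)"

definition Upsi :: "qf poly \<Rightarrow> qf poly" where
  "Upsi x = map_poly qbar x"

definition tdot :: "nat \<Rightarrow> qf poly" where
  "tdot n = (let a = n div 2;
                 P = (\<Prod>j\<in>{- int a + 1..int a}. [:- qint (2 * j - 1), 1:])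
             in if even n then smult (inverse (qfact n)) P
                else smult (inverse (qfact n)) ([:0, 1:] * P))"

text \<open>v is the imath-canonical basis element b^mu_a of L(mu):
  psi_imath(v) = v (psi_imath(x v^+) = psi_imath(x) v^+), and
  v in F^(a)v^+ + sum_{r<a} q^-1 Z[q^-1] F^(r) v^+.\<close>
definition icb_elem :: "qf \<Rightarrow> nat \<Rightarrow> nat \<Rightarrow> vec \<Rightarrow> bool" where
  "icb_elem \<kappa> \<mu> a v \<longleftrightarrow> a \<le> \<mu> \<and> in_L \<mu> v \<and>
     (\<exists>x. act \<kappa> \<mu> x hwv = v \<and> act \<kappa> \<mu> (Upsi x) hwv = v) \<and>
     v a = 1 \<and> (\<forall>r<a. in_qinvZ (v r)) \<and> (\<forall>r. a < r \<longrightarrow> v r = 0)"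

definition AUodd :: "qf \<Rightarrow> qf poly set" where
  "AUodd \<kappa> = {x. \<forall>\<mu> v. odd \<mu> \<longrightarrow> in_L \<mu> v \<longrightarrow> (\<forall>a. in_A (v a)) \<longrightarrow>
                     (\<forall>a. in_A (act \<kappa> \<mu> x v a))}"

end

theory Submission
  imports Defs
begin

text \<open>
  Write x_n for the divided powers of the theorem and y_n for their analogues for even weights.
  Both satisfy t x_n = [n+1] x_(n+1) + d_n [n] x_(n-1), where d_n is 1 for n odd (odd weights),
  respectively n even (even weights), and 0 otherwise.

  The module L(mu+1) embeds into L(mu) tensor L(1), on which t acts as the 2x2 matrix over Q(q)[t]
  with rows (t/q, 1) and (1, qt), and a vector of L(mu+1) is integral iff its image is. Under this
  embedding x_n becomes the matrix with off-diagonal entries y_(n-1) and diagonal entries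
  q^(-n) y_n + d_n q^(1-n) y_(n-2) and q^n y_n + d_n q^(n-1) y_(n-2); likewise with x and y
  exchanged. Induction on mu thus reduces integrality to L(0), where t acts by [2l].

  Applied to the highest weight vector, the same matrices show that the coefficient of F^(r) v^+ in
  x_n v^+ is c(mu-r, n-r), where c(mu, 0) = 1 and
  c(mu+1, n) = q^(-n) c(mu, n) + d_n q^(1-n) c(mu, n-2). For n > 0 the powers of 1/q push c(mu, n)
  into q^(-1) Z[q^(-1)] as mu grows.
\<close>

section \<open>The field of rational functions in q\<close>

lemma qq_nonzero [simp]: "qq \<noteq> 0"
  by (simp add: qq_def Zero_fract_def eq_fract)

lemma qq_power: "qq ^ n = Fract (monom 1 n) 1"
proof (induction n)
  case 0
  show ?case by (simp add: One_fract_def)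
next
  case (Suc n)
  then show ?case by (simp add: qq_def monom_Suc)
qed

lemma qq_power_eq_1_iff [simp]: "qq ^ n = 1 \<longleftrightarrow> n = 0"
proof -
  have "qq ^ n = 1 \<longleftrightarrow> monom (1::rat) n = 1"
    by (simp add: qq_power One_fract_def eq_fract)
  also have "\<dots> \<longleftrightarrow> n = 0"
    by (metis degree_1 degree_monom_eq monom_eq_1 one_neq_zero)
  finally show ?thesis .
qed

lemma qq_neq_inverse [simp]: "qq \<noteq> inverse qq"
proof
  assume "qq = inverse qq"
  then have "qq ^ 2 = 1" by (metis power2_eq_square qq_nonzero right_inverse)
  then show False by simp
qed

lemma qint_0 [simp]: "qint 0 = 0"
  by (simp add: qint_def)

lemma qint_1 [simp]: "qint 1 = 1"
  by (simp add: qint_def)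

lemma qint_minus: "qint (- k) = - qint k"
  by (simp add: qint_def minus_divide_left)

lemma qint_nonzero: "k > 0 \<Longrightarrow> qint k \<noteq> 0"
proof
  assume "k > 0" and "qint k = 0"
  then have "qq powi k = qq powi (- k)" by (simp add: qint_def)
  then have "qq powi k * qq powi k = 1"
    by (metis power_int_minus power_int_not_zero qq_nonzero right_inverse)
  then have "qq ^ (nat k + nat k) = 1" using \<open>k > 0\<close> by (simp add: power_add power_int_def)
  then show False using \<open>k > 0\<close> by (simp del: power_add)
qed

text \<open>This recursion and its mirror image under q -> q^(-1), which follows it, provide the
  splittings [k+1] = c [k] + c^(-k) for c = q^(-1) and c = q. They belong to the two rows of the
  branching matrix.\<close>

lemma qint_Suc: "qint (k + 1) = inverse qq * qint k + qq powi k"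
proof -
  have "(qq - inverse qq) * qint (k + 1) = qq powi k * qq - inverse (qq powi k * qq)"
    by (simp add: qint_def power_int_add power_int_diff power_int_minus divide_inverse)
  also have "\<dots> = (qq - inverse qq) * (inverse qq * qint k + qq powi k)"
    by (simp add: qint_def power_int_minus distrib_left) (simp add: algebra_simps)
  finally show ?thesis by simp
qed

lemma qint_Suc': "qint (k + 1) = qq * qint k + qq powi (- k)"
proof -
  have "(qq - inverse qq) * qint (k + 1) = qq powi k * qq - inverse (qq powi k * qq)"
    by (simp add: qint_def power_int_add power_int_diff power_int_minus divide_inverse)
  also have "\<dots> = (qq - inverse qq) * (qq * qint k + qq powi (- k))"
    by (simp add: qint_def power_int_minus distrib_left) (simp add: algebra_simps)
  finally show ?thesis by simp
qed

section \<open>Integral Laurent polynomials and q^(-1) Z[q^(-1)]\<close>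

definition of_int_poly_q :: "int poly \<Rightarrow> qf" where
  "of_int_poly_q p = Fract (map_poly of_int p) 1"

lemma map_poly_of_int_add:
  "map_poly of_int (p + r) = map_poly of_int p + (map_poly of_int r :: rat poly)"
  by (rule poly_eqI) (simp add: coeff_map_poly)

lemma map_poly_of_int_mult:
  "map_poly of_int (p * r) = map_poly of_int p * (map_poly of_int r :: rat poly)"
  by (rule poly_eqI) (simp add: coeff_map_poly coeff_mult)

lemma of_int_poly_q_add: "of_int_poly_q (p + r) = of_int_poly_q p + of_int_poly_q r"
  by (simp add: of_int_poly_q_def map_poly_of_int_add)

lemma of_int_poly_q_mult: "of_int_poly_q (p * r) = of_int_poly_q p * of_int_poly_q r"
  by (simp add: of_int_poly_q_def map_poly_of_int_mult)

lemma of_int_poly_q_monom: "of_int_poly_q (monom 1 n) = qq ^ n"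
  by (simp add: of_int_poly_q_def qq_power map_poly_monom)

lemma of_int_poly_q_0 [simp]: "of_int_poly_q 0 = 0"
  by (simp add: of_int_poly_q_def Zero_fract_def)

lemma of_int_poly_q_minus_1: "of_int_poly_q (- 1) = - 1"
proof -
  have "of_int_poly_q 1 + of_int_poly_q (- 1) = 0"
    by (simp flip: of_int_poly_q_add)
  moreover have "of_int_poly_q 1 = 1"
    using of_int_poly_q_monom[of 0] by simp
  ultimately show ?thesis by (simp add: add_eq_0_iff)
qed

text \<open>Clearing the denominator q^k turns membership into an equation over the image of Z[q],
  so closure properties reduce to finding a common power of q.\<close>

lemma in_A_iff: "in_A x \<longleftrightarrow> (\<exists>p k. x * qq ^ k = of_int_poly_q p)"
proof -
  have "x = y * qq powi (- int k) \<longleftrightarrow> x * qq ^ k = y" for y k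
    by (auto simp: power_int_minus)
  then show ?thesis by (auto simp: in_A_def of_int_poly_q_def)
qed

text \<open>The strict bound \<open>degree p < d\<close> says that p(q) q^(-d) contains only
  negative powers of q.\<close>

lemma in_qinvZ_iff: "in_qinvZ x \<longleftrightarrow> (\<exists>p d. degree p < d \<and> x * qq ^ d = of_int_poly_q p)"
proof -
  have "x = Fract r (monom 1 d) \<longleftrightarrow> x * qq ^ d = Fract r 1" for r d
  proof -
    have "Fract r (monom 1 d) * qq ^ d = Fract r 1"
      by (simp add: qq_power eq_fract)
    then show ?thesis by (metis mult_right_cancel power_not_zero qq_nonzero)
  qed
  then show ?thesis by (auto simp: in_qinvZ_def of_int_poly_q_def)
qed

lemma in_A_0 [simp]: "in_A 0"
  unfolding in_A_iff by (metis mult_zero_left of_int_poly_q_0)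

lemma in_A_add: "in_A x \<Longrightarrow> in_A y \<Longrightarrow> in_A (x + y)"
proof -
  assume "in_A x" "in_A y"
  then obtain p k r m where "x * qq ^ k = of_int_poly_q p" "y * qq ^ m = of_int_poly_q r"
    by (auto simp: in_A_iff)
  then have "(x + y) * qq ^ (k + m) = of_int_poly_q (p * monom 1 m + r * monom 1 k)"
    by (simp add: of_int_poly_q_add of_int_poly_q_mult of_int_poly_q_monom power_add
        flip: \<open>x * _ = _\<close> \<open>y * _ = _\<close>) (simp add: algebra_simps)
  then show ?thesis by (auto simp: in_A_iff)
qed

lemma in_A_mult: "in_A x \<Longrightarrow> in_A y \<Longrightarrow> in_A (x * y)"
proof -
  assume "in_A x" "in_A y"
  then obtain p k r m where "x * qq ^ k = of_int_poly_q p" "y * qq ^ m = of_int_poly_q r"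
    by (auto simp: in_A_iff)
  then have "(x * y) * qq ^ (k + m) = of_int_poly_q (p * r)"
    by (simp add: of_int_poly_q_mult power_add flip: \<open>x * _ = _\<close> \<open>y * _ = _\<close>)
  then show ?thesis by (auto simp: in_A_iff)
qed

lemma in_A_minus_1: "in_A (- 1)"
  unfolding in_A_iff by (metis mult.right_neutral of_int_poly_q_minus_1 power_0)

lemma in_A_minus: "in_A x \<Longrightarrow> in_A (- x)"
  using in_A_mult[OF in_A_minus_1] by simp

lemma in_A_diff: "in_A x \<Longrightarrow> in_A y \<Longrightarrow> in_A (x - y)"
  using in_A_add[OF _ in_A_minus] by simp

lemma in_A_1 [simp]: "in_A 1"
  using in_A_minus[OF in_A_minus_1] by simp

lemma in_A_sum: "(\<And>i. i \<in> I \<Longrightarrow> in_A (f i)) \<Longrightarrow> in_A (sum f I)"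
  by (induction I rule: infinite_finite_induct) (auto intro: in_A_add)

lemma in_A_qq_powi [simp]: "in_A (qq powi k)"
proof (cases "k \<ge> 0")
  case True
  then have "qq powi k * qq ^ 0 = of_int_poly_q (monom 1 (nat k))"
    by (simp add: of_int_poly_q_monom power_int_def)
  then show ?thesis unfolding in_A_iff by blast
next
  case False
  then have "qq powi k * qq ^ nat (- k) = of_int_poly_q (monom 1 0)"
    by (simp only: of_int_poly_q_monom) (simp add: power_int_def power_inverse)
  then show ?thesis unfolding in_A_iff by blast
qed

lemma inverse_qq_powi: "inverse qq powi k = qq powi (- k)"
  by (simp add: power_int_inverse power_int_minus)

lemma in_qinvZ_0 [simp]: "in_qinvZ 0"
  unfolding in_qinvZ_iff by (metis degree_0 lessI mult_zero_left of_int_poly_q_0)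

lemma in_qinvZ_add: "in_qinvZ x \<Longrightarrow> in_qinvZ y \<Longrightarrow> in_qinvZ (x + y)"
proof -
  assume "in_qinvZ x" "in_qinvZ y"
  then obtain p k r m where *: "degree p < k" "degree r < m"
    and eq: "x * qq ^ k = of_int_poly_q p" "y * qq ^ m = of_int_poly_q r"
    by (auto simp: in_qinvZ_iff)
  have "(x + y) * qq ^ (k + m) = of_int_poly_q (p * monom 1 m + r * monom 1 k)"
    by (simp add: of_int_poly_q_add of_int_poly_q_mult of_int_poly_q_monom power_add
        flip: eq) (simp add: algebra_simps)
  moreover have "degree (p * monom 1 m) < k + m" "degree (r * monom 1 k) < k + m"
    using * by (auto intro!: le_less_trans[OF degree_mult_le] simp: degree_monom_eq)
  then have "degree (p * monom 1 m + r * monom 1 k) < k + m"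
    by (rule degree_add_less)
  ultimately show ?thesis by (auto simp: in_qinvZ_iff)
qed

lemma inverse_qq_power_cancel: "inverse qq ^ n * x * qq ^ (k + n) = x * qq ^ k"
proof -
  have "inverse qq ^ n * x * qq ^ (k + n) = (inverse qq * qq) ^ n * (x * qq ^ k)"
    by (simp only: power_add power_mult_distrib mult_ac)
  then show ?thesis by simp
qed

lemma in_qinvZ_mult_power:
  assumes "in_qinvZ x" shows "in_qinvZ (inverse qq ^ n * x)"
proof -
  from assms obtain p k where *: "degree p < k" "x * qq ^ k = of_int_poly_q p"
    by (auto simp: in_qinvZ_iff)
  then have "inverse qq ^ n * x * qq ^ (k + n) = of_int_poly_q p"
    by (simp only: inverse_qq_power_cancel)
  with *(1) show ?thesis unfolding in_qinvZ_iff by (meson trans_less_add1)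
qed

text \<open>A Laurent polynomial has a highest power of q. If q^k x = p(q), then
  \<open>Suc (degree p)\<close> factors q^(-1) push all powers below q^0.\<close>

lemma in_A_imp_eventually_in_qinvZ:
  assumes "in_A x" shows "\<exists>N. in_qinvZ (inverse qq ^ N * x)"
proof -
  from assms obtain p k where *: "x * qq ^ k = of_int_poly_q p"
    by (auto simp: in_A_iff)
  then have "inverse qq ^ Suc (degree p) * x * qq ^ (k + Suc (degree p)) = of_int_poly_q p"
    by (simp only: inverse_qq_power_cancel)
  then show ?thesis unfolding in_qinvZ_iff
    by (intro exI[of _ "Suc (degree p)"] exI[of _ p] exI[of _ "k + Suc (degree p)"]) simp
qed

section \<open>The bar involution\<close>

definition q_const :: "rat \<Rightarrow> qf" where
  "q_const c = Fract [:c:] 1"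

lemma q_const_0 [simp]: "q_const 0 = 0"
  by (simp add: q_const_def Zero_fract_def)

lemma q_const_add: "q_const (b + c) = q_const b + q_const c"
  by (simp add: q_const_def)

lemma q_const_mult: "q_const (b * c) = q_const b * q_const c"
  by (simp add: q_const_def mult.commute)

text \<open>This is the substitution q -> q^(-1) as a ring homomorphism from Q[q] to Q(q).
  Reflection of polynomials is not additive, so the ring properties of \<open>qbar\<close> are
  derived through this map.\<close>

definition eval_qinv :: "rat poly \<Rightarrow> qf" where
  "eval_qinv p = poly (map_poly q_const p) (inverse qq)"

lemma eval_qinv_pCons: "eval_qinv (pCons c p) = q_const c + inverse qq * eval_qinv p"
  by (simp add: eval_qinv_def map_poly_pCons)

lemma eval_qinv_0 [simp]: "eval_qinv 0 = 0"
  by (simp add: eval_qinv_def)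

lemma eval_qinv_1 [simp]: "eval_qinv 1 = 1"
  using eval_qinv_pCons[of 1 0] by (simp add: q_const_def One_fract_def pCons_one)

lemma eval_qinv_add: "eval_qinv (p + r) = eval_qinv p + eval_qinv r"
  by (induction p r rule: poly_induct2) (auto simp: eval_qinv_pCons q_const_add algebra_simps)

lemma eval_qinv_smult: "eval_qinv (smult c p) = q_const c * eval_qinv p"
  by (induction p) (auto simp: eval_qinv_pCons q_const_mult algebra_simps)

lemma eval_qinv_mult: "eval_qinv (p * r) = eval_qinv p * eval_qinv r"
  by (induction p) (auto simp: eval_qinv_pCons eval_qinv_smult eval_qinv_add algebra_simps)

lemma reflect_poly_eq_eval_qinv:
  "Fract (reflect_poly p) (monom 1 (degree p)) = eval_qinv p"
proof (induction p)
  case 0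
  show ?case by (simp add: Zero_fract_def eq_fract)
next
  case (pCons c p)
  show ?case
  proof (cases "p = 0")
    case True
    then show ?thesis by (simp add: eval_qinv_pCons q_const_def)
  next
    case False
    let ?d = "degree p"
    have "Fract (reflect_poly (pCons c p)) (monom 1 (degree (pCons c p)))
        = Fract (reflect_poly p * 1 + [:c:] * monom 1 (Suc ?d)) (monom 1 (Suc ?d))"
      using False by (simp add: reflect_poly_pCons' smult_monom)
    also have "\<dots> = q_const c + Fract (reflect_poly p) (monom 1 (Suc ?d))"
      unfolding q_const_def by (subst add_fract) (auto simp: add.commute)
    also have "Fract (reflect_poly p) (monom 1 (Suc ?d))
        = inverse qq * Fract (reflect_poly p) (monom 1 ?d)"
      by (simp add: qq_def monom_Suc)
    also have "\<dots> = inverse qq * eval_qinv p"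
      by (simp only: pCons.IH)
    finally show ?thesis by (simp only: eval_qinv_pCons)
  qed
qed

lemma eval_qinv_eq_0_iff [simp]: "eval_qinv p = 0 \<longleftrightarrow> p = 0"
  by (simp add: Zero_fract_def eq_fract flip: reflect_poly_eq_eval_qinv)

text \<open>The reduced fraction in the definition of \<open>qbar\<close> may be replaced by any
  other one: cross-multiplied equations survive the homomorphism \<open>eval_qinv\<close>, which is
  injective and hence keeps denominators nonzero.\<close>

lemma qbar_Fract:
  assumes "b \<noteq> 0"
  shows "qbar (Fract a b) = eval_qinv a / eval_qinv b"
proof -
  obtain c d where cd: "quot_of_fract (Fract a b) = (c, d)" by force
  then have d: "d \<noteq> 0" and "Fract c d = Fract a b"
    by (metis snd_conv snd_quot_of_fract_nonzero, metis Fract_quot_of_fract fst_conv snd_conv)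
  then have "c * b = a * d" using assms by (simp add: eq_fract)
  then have eq: "eval_qinv c * eval_qinv b = eval_qinv a * eval_qinv d"
    by (metis eval_qinv_mult)
  have "qbar (Fract a b) = Fract (reflect_poly c * monom 1 (degree d)) (reflect_poly d * monom 1 (degree c))"
    by (simp add: qbar_def cd)
  also have "\<dots> = Fract (reflect_poly c) (monom 1 (degree c)) / Fract (reflect_poly d) (monom 1 (degree d))"
    by (simp add: mult.commute)
  also have "\<dots> = eval_qinv c / eval_qinv d"
    by (simp only: reflect_poly_eq_eval_qinv)
  also have "\<dots> = eval_qinv a / eval_qinv b"
    using eq d assms by (simp add: field_simps)
  finally show ?thesis .
qed

lemma qbar_0 [simp]: "qbar 0 = 0" and qbar_1 [simp]: "qbar 1 = 1"
  using qbar_Fract[of 1 0] qbar_Fract[of 1 1]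
  by (simp_all add: Zero_fract_def[symmetric] One_fract_def[symmetric])

lemma qbar_add: "qbar (x + y) = qbar x + qbar y"
  by (cases x, cases y)
    (simp add: qbar_Fract eval_qinv_add eval_qinv_mult field_simps)

lemma qbar_mult: "qbar (x * y) = qbar x * qbar y"
  by (cases x, cases y) (simp add: qbar_Fract eval_qinv_mult)

lemma qbar_minus: "qbar (- x) = - qbar x"
  using qbar_add[of x "- x"] by (simp add: add_eq_0_iff)

lemma qbar_diff: "qbar (x - y) = qbar x - qbar y"
  using qbar_add[of x "- y"] by (simp add: qbar_minus)

lemma qbar_inverse: "qbar (inverse x) = inverse (qbar x)"
proof (cases "x = 0")
  case False
  then have "qbar x * qbar (inverse x) = 1" by (simp flip: qbar_mult)
  then show ?thesis by (simp add: inverse_unique)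
qed simp

lemma qbar_qq: "qbar qq = inverse qq"
  by (simp add: qq_def qbar_Fract eval_qinv_pCons q_const_def pCons_one)

lemma qbar_power: "qbar (x ^ n) = qbar x ^ n"
  by (induction n) (simp_all add: qbar_mult)

lemma qbar_qq_powi: "qbar (qq powi k) = qq powi (- k)"
  by (simp add: power_int_def qbar_power qbar_inverse qbar_qq)

text \<open>Numerator and denominator of [k] both change sign under the bar involution.\<close>

lemma qbar_qint: "qbar (qint k) = qint k"
proof -
  have "qbar (qint k) = (qq powi (- k) - qq powi k) / (inverse qq - qq)"
    by (simp add: qint_def divide_inverse qbar_mult qbar_diff qbar_inverse qbar_qq_powi qbar_qq)
  also have "\<dots> = qint k"
    by (metis qint_def minus_diff_eq minus_divide_divide)
  finally show ?thesis .
qed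

section \<open>Divided powers and the branching of modules\<close>

lemma act_eq_sum:
  assumes "degree x \<le> N"
  shows "act \<kappa> \<mu> x v a = (\<Sum>i\<le>N. coeff x i * ((t_act \<kappa> \<mu> ^^ i) v) a)"
  unfolding act_def
  by (rule sum.mono_neutral_left) (use assms in \<open>auto simp: coeff_eq_0\<close>)

lemma act_add: "act \<kappa> \<mu> (x + y) v a = act \<kappa> \<mu> x v a + act \<kappa> \<mu> y v a"
proof -
  let ?N = "max (degree x) (degree y)"
  have "degree (x + y) \<le> ?N" by (rule degree_add_le_max)
  then show ?thesis
    by (simp add: act_eq_sum[where N = ?N] algebra_simps sum.distrib)
qed

lemma act_smult: "act \<kappa> \<mu> (smult c x) v a = c * act \<kappa> \<mu> x v a"
  by (simp add: act_eq_sum[where N = "degree x"] degree_smult_le sum_distrib_left mult.assoc)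

lemma act_0 [simp]: "act \<kappa> \<mu> 0 v a = 0"
  by (simp add: act_def)

lemma act_1 [simp]: "act \<kappa> \<mu> 1 v = v"
  by (simp add: act_def)

lemma act_sum: "act \<kappa> \<mu> (\<Sum>i\<in>I. f i) v a = (\<Sum>i\<in>I. act \<kappa> \<mu> (f i) v a)"
  by (induction I rule: infinite_finite_induct) (auto simp: act_add)

lemma t_act_add: "t_act \<kappa> \<mu> (\<lambda>a. u a + v a) a = t_act \<kappa> \<mu> u a + t_act \<kappa> \<mu> v a"
  by (simp add: t_act_def algebra_simps)

lemma t_act_scale: "t_act \<kappa> \<mu> (\<lambda>a. c * v a) a = c * t_act \<kappa> \<mu> v a"
  by (simp add: t_act_def algebra_simps)

lemma t_act_0: "t_act \<kappa> \<mu> (\<lambda>a. 0) a = 0"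
  by (simp add: t_act_def)

lemma t_act_sum: "t_act \<kappa> \<mu> (\<lambda>a. \<Sum>i\<in>I. f i a) a = (\<Sum>i\<in>I. t_act \<kappa> \<mu> (f i) a)"
  by (induction I rule: infinite_finite_induct) (auto simp: t_act_add t_act_0)

lemma act_pCons_0: "act \<kappa> \<mu> (pCons 0 x) v a = t_act \<kappa> \<mu> (act \<kappa> \<mu> x v) a"
proof -
  have "act \<kappa> \<mu> (pCons 0 x) v a
      = (\<Sum>i\<le>Suc (degree x). coeff (pCons 0 x) i * ((t_act \<kappa> \<mu> ^^ i) v) a)"
    by (rule act_eq_sum) (simp add: degree_pCons_le)
  also have "\<dots> = (\<Sum>i\<le>degree x. coeff x i * t_act \<kappa> \<mu> ((t_act \<kappa> \<mu> ^^ i) v) a)"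
    by (simp only: sum.atMost_Suc_shift) simp
  also have "\<dots> = t_act \<kappa> \<mu> (act \<kappa> \<mu> x v) a"
    unfolding act_def by (simp add: t_act_sum t_act_scale)
  finally show ?thesis .
qed

lemma act_zero_vec: "act \<kappa> \<mu> x (\<lambda>_. 0) a = 0"
proof -
  have "(t_act \<kappa> \<mu> ^^ i) (\<lambda>_. 0) = (\<lambda>_. 0)" for i
    by (induction i) (simp_all add: t_act_0 fun_eq_iff[of "t_act _ _ _"])
  then show ?thesis by (simp add: act_def)
qed

lemma in_L_t_act: "in_L \<mu> (t_act \<kappa> \<mu> v)"
  by (simp add: in_L_def t_act_def)

lemma in_L_act:
  assumes "in_L \<mu> v" shows "in_L \<mu> (act \<kappa> \<mu> x v)"
proof -
  have "in_L \<mu> ((t_act \<kappa> \<mu> ^^ i) v)" for i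
    using assms by (cases i) (auto simp: in_L_t_act)
  then show ?thesis by (simp add: in_L_def act_def)
qed

text \<open>The module L(0) is one-dimensional: E and F act by 0 and K by 1, so t acts as the scalar
  kappa.\<close>

lemma act_L0: "act \<kappa> 0 x v 0 = poly x \<kappa> * v 0"
proof -
  have "((t_act \<kappa> 0 ^^ i) v) 0 = \<kappa> ^ i * v 0" for i
    by (induction i) (auto simp: t_act_def)
  then show ?thesis by (simp add: act_def poly_altdef sum_distrib_right mult.assoc)
qed

section \<open>Divided powers through their three-term recursion\<close>

definition has_lower_term :: "bool \<Rightarrow> int \<Rightarrow> bool" where
  "has_lower_term e k \<longleftrightarrow> odd k = e"

text \<open>The flag \<open>e\<close> is the parity of the weights and
  \<open>has_lower_term e k\<close> is the condition d_k = 1. Shifting k by one and switching the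
  parity both negate it, which is what lets the recursions for the two parities interlock.\<close>

lemma has_lower_term_simps [simp]:
  "has_lower_term e (k + 1) \<longleftrightarrow> \<not> has_lower_term e k"
  "has_lower_term e (k - 1) \<longleftrightarrow> \<not> has_lower_term e k"
  "has_lower_term e (k - 2) \<longleftrightarrow> has_lower_term e k"
  "has_lower_term (\<not> e) k \<longleftrightarrow> \<not> has_lower_term e k"
  by (auto simp: has_lower_term_def)

text \<open>The divided powers x_n (\<open>e = True\<close>, odd weights) and y_n (\<open>e = False\<close>, even weights),
  extended by 0 to negative indices so that their recursion holds for every integer.\<close>
fun idp_nat :: "bool \<Rightarrow> nat \<Rightarrow> qf poly" where
  "idp_nat e 0 = 1"
| "idp_nat e (Suc n) = smult (inverse (qint (int n + 1)))
     (pCons 0 (idp_nat e n)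
      - (if has_lower_term e (int n) then smult (qint (int n)) (idp_nat e (n - 1)) else 0))"

definition idp :: "bool \<Rightarrow> int \<Rightarrow> qf poly" where
  "idp e k = (if k < 0 then 0 else idp_nat e (nat k))"

lemma idp_neg [simp]: "k < 0 \<Longrightarrow> idp e k = 0"
  by (simp add: idp_def)

lemma idp_0 [simp]: "idp e 0 = 1"
  by (simp add: idp_def)

lemma idp_rec:
  "pCons 0 (idp e k) =
     smult (qint (k + 1)) (idp e (k + 1))
     + (if has_lower_term e k then smult (qint k) (idp e (k - 1)) else 0)"
proof (cases "k \<ge> 0")
  case True
  then obtain n where k: "k = int n" using nonneg_int_cases by blast
  have "qint (int n + 1) \<noteq> 0" by (rule qint_nonzero) simp
  moreover have "idp e (k + 1) = idp_nat e (Suc n)"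
    using k by (simp add: idp_def nat_add_distrib)
  \<comment> \<open>For \<open>n = 0\<close> truncated subtraction gives \<open>n - 1 = 0\<close>,
    while the integer index is -1; the factor [0] = 0 removes both terms.\<close>
  moreover have "smult (qint k) (idp e (k - 1)) = smult (qint (int n)) (idp_nat e (n - 1))"
    using k by (cases n) (auto simp: idp_def)
  ultimately show ?thesis
    using k by (simp add: idp_def)
next
  case False
  \<comment> \<open>At k = -1 the nonzero polynomial \<open>idp e 0\<close> appears on the right,
    but with the factor [0] = 0.\<close>
  then show ?thesis by (cases "k = - 1") auto
qed

lemma act_idp_rec:
  "t_act \<kappa> \<mu> (act \<kappa> \<mu> (idp e k) v) a =
     qint (k + 1) * act \<kappa> \<mu> (idp e (k + 1)) v a
     + (if has_lower_term e k then qint k * act \<kappa> \<mu> (idp e (k - 1)) v a else 0)"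
  by (simp add: act_add act_smult idp_rec flip: act_pCons_0)

section \<open>The branching matrix of the divided powers\<close>

definition branch_comb :: "qf \<Rightarrow> bool \<Rightarrow> (int \<Rightarrow> qf) \<Rightarrow> (int \<Rightarrow> qf) \<Rightarrow> int \<Rightarrow> qf" where
  "branch_comb c e y z k = c powi k * y k
     + (if has_lower_term e k then c powi (k - 1) * y (k - 2) else 0) + z (k - 1)"

text \<open>\<open>branch_comb\<close> is one row of the matrix of a divided power, applied to a
  pair: \<open>y\<close> carries the diagonal entry and \<open>z\<close> the off-diagonal one, with
  c = q^(-1) in the first row and c = q in the second. The matrix of t has c on the diagonal and 1
  off it, so the identity says that the rows obey the recursion with flag \<open>e\<close> once the
  entries obey the one with the opposite flag. \<open>Ty\<close> and \<open>Tz\<close> stay abstract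
  so that t may be an operator on a module or multiplication by a scalar.\<close>

lemma branch_comb_rec:
  assumes c: "c \<noteq> 0" and B: "\<And>k. qint (k + 1) = c * qint k + c powi (- k)"
    and Ty: "\<And>k. Ty k = qint (k + 1) * y (k + 1)
      + (if has_lower_term (\<not> e) k then qint k * y (k - 1) else 0)"
    and Tz: "\<And>k. Tz k = qint (k + 1) * z (k + 1)
      + (if has_lower_term (\<not> e) k then qint k * z (k - 1) else 0)"
  shows "c * branch_comb c e Ty Tz k + branch_comb (inverse c) e z y k =
     qint (k + 1) * branch_comb c e y z (k + 1)
     + (if has_lower_term e k then qint k * branch_comb c e y z (k - 1) else 0)"
proof -
  have p: "c powi (k + 1) = c * c powi k" "inverse c powi k = inverse (c powi k)"
    "inverse c powi (k - 1) = c * inverse (c powi k)" "c powi k \<noteq> 0"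
    "c powi (k - 1) = c powi k * inverse c" "c powi (- k) = inverse (c powi k)"
    using c by (simp_all add: power_int_add power_int_diff power_int_inverse power_int_minus field_simps)
  have B1: "qint (k + 1) = c * qint k + inverse (c powi k)"
    using B[of k] p by simp
  have B2: "qint k = c * qint (k - 1) + c * inverse (c powi k)"
    using B[of "k - 1"] c by (simp add: power_int_diff divide_inverse)
  show ?thesis
  proof (cases "has_lower_term e k")
    case True
    \<comment> \<open>Only when the lower term is present does [k-1] occur, from
      \<open>Ty (k - 2)\<close> and \<open>Tz (k - 1)\<close>; it is eliminated in favour of
      [k].\<close>
    have "qint (k - 1) = inverse c * qint k - inverse (c powi k)"
      using B2 c by (simp add: field_simps)
    then show ?thesis using True c p(4)
      by (simp add: branch_comb_def Ty Tz p(1-3,5-6) B1) (simp add: field_simps)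
  next
    case False
    then show ?thesis using c p(4)
      by (simp add: branch_comb_def Ty Tz p(1-3,5-6) B1) (simp add: field_simps)
  qed
qed

lemma t_act_branch_comb:
  "t_act \<kappa> \<mu> (\<lambda>a. branch_comb c e (\<lambda>k. Y k a) (\<lambda>k. Z k a) k) a =
   branch_comb c e (\<lambda>k. t_act \<kappa> \<mu> (Y k) a) (\<lambda>k. t_act \<kappa> \<mu> (Z k) a) k"
  by (simp add: branch_comb_def t_act_add t_act_scale t_act_0)

text \<open>The two components of the embedding of L(mu+1) into L(mu) tensor L(1), which sends F^(a) v^+ to
  q^(-a) F^(a) v^+ tensor w_+ plus F^(a-1) v^+ tensor w_-.\<close>
definition res_plus :: "nat \<Rightarrow> vec \<Rightarrow> vec" where
  "res_plus \<mu> v = (\<lambda>a. if a \<le> \<mu> then qq powi (- int a) * v a else 0)"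

definition res_minus :: "vec \<Rightarrow> vec" where
  "res_minus v = (\<lambda>a. v (a + 1))"

lemma in_L_res_plus: "in_L \<mu> (res_plus \<mu> v)"
  by (simp add: in_L_def res_plus_def)

lemma in_L_res_minus: "in_L (Suc \<mu>) v \<Longrightarrow> in_L \<mu> (res_minus v)"
  by (simp add: in_L_def res_minus_def)

text \<open>This is the first row (t/q, 1) of the matrix of t. The coefficient of E splits as
  [mu+1-a] = q^(-1) [mu-a] + q^(mu-a); the first summand belongs to t/q, the second yields
  \<open>res_minus\<close>.\<close>

lemma res_plus_t_act:
  assumes "in_L (Suc \<mu>) v"
  shows "res_plus \<mu> (t_act \<kappa> (Suc \<mu>) v) a = inverse qq * t_act \<kappa> \<mu> (res_plus \<mu> v) a + res_minus v a"
proof (cases "a \<le> \<mu>")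
  case False
  then show ?thesis using assms by (simp add: res_plus_def res_minus_def t_act_def in_L_def)
next
  case True
  define m where "m = int \<mu> - int a"
  have \<mu>: "int \<mu> = m + int a" by (simp add: m_def)
  define A where "A = qq powi int a"
  define R where "R = qq powi m"
  have nz: "A \<noteq> 0" "R \<noteq> 0" by (auto simp: A_def R_def)
  have p: "qq powi (2 * int a + 1 - int (Suc \<mu>)) = A * inverse R"
      "qq powi (2 * int a - int (Suc \<mu>)) = A * inverse R * inverse qq"
      "qq powi (2 * int a + 1 - int \<mu>) = A * inverse R * qq"
      "qq powi (2 * int a - int \<mu>) = A * inverse R"
      "qq powi (- int a) = inverse A"
    by (simp_all add: A_def R_def \<mu> power_int_diff power_int_add power_int_minus field_simps)
  have B: "qint (int (Suc \<mu>) - int a) = inverse qq * qint m + R"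
    using qint_Suc[of m] by (simp add: \<mu> R_def add_ac)
  have 0: "a \<noteq> 0 \<Longrightarrow> res_plus \<mu> v (a - 1) = qq * inverse A * v (a - 1)"
    using True by (simp add: res_plus_def A_def power_int_diff of_nat_diff power_int_minus field_simps)
  have 2: "res_plus \<mu> v a = inverse A * v a"
    using True by (simp add: res_plus_def p)
  \<comment> \<open>At a = mu the truncation in \<open>res_plus\<close> discards the entry a + 1,
    and the factor [m] = [0] discards it on the other side.\<close>
  have 1: "qint m * res_plus \<mu> v (a + 1) = qint m * (inverse A * inverse qq * v (a + 1))"
  proof (cases "a = \<mu>")
    case True
    then show ?thesis by (simp add: m_def)
  next
    case False
    then show ?thesis using True
      by (simp add: res_plus_def A_def power_int_add power_int_diff power_int_minus field_simps)
  qed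
  have tR: "t_act \<kappa> \<mu> (res_plus \<mu> v) a = (if a = 0 then 0 else qint (int a) * (qq * inverse A * v (a - 1)))
      + A * inverse R * qq * (qint m * res_plus \<mu> v (a + 1)) + \<kappa> * (A * inverse R) * (inverse A * v a)"
    using True by (simp add: t_act_def p 0[simplified] 2 flip: m_def)
  have "res_plus \<mu> (t_act \<kappa> (Suc \<mu>) v) a = inverse A * ((if a = 0 then 0 else qint (int a) * v (a - 1))
      + A * inverse R * (inverse qq * qint m + R) * v (a + 1) + \<kappa> * (A * inverse R * inverse qq) * v a)"
    using True by (simp add: res_plus_def t_act_def p B del: of_nat_Suc)
  moreover have "inverse qq * t_act \<kappa> \<mu> (res_plus \<mu> v) a + res_minus v a = \<dots>"
    unfolding tR 1 using nz
    by (cases "a = 0") (simp_all add: res_minus_def field_simps)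
  ultimately show ?thesis by simp
qed

text \<open>This is the second row (1, qt). Here the coefficient of F splits as [a+1] = q [a] +
  q^(-a), and the second summand yields \<open>res_plus\<close>.\<close>

lemma res_minus_t_act:
  assumes "in_L (Suc \<mu>) v"
  shows "res_minus (t_act \<kappa> (Suc \<mu>) v) a = qq * t_act \<kappa> \<mu> (res_minus v) a + res_plus \<mu> v a"
proof (cases "a \<le> \<mu>")
  case False
  then show ?thesis using assms by (simp add: res_plus_def res_minus_def t_act_def in_L_def)
next
  case True
  have p: "qq powi (2 * int (a + 1) + 1 - int (Suc \<mu>)) = qq * qq powi (2 * int a + 1 - int \<mu>)"
      "qq powi (2 * int (a + 1) - int (Suc \<mu>)) = qq * qq powi (2 * int a - int \<mu>)"
    by (simp_all add: power_int_diff power_int_add field_simps power2_eq_square)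
  have i: "int (Suc \<mu>) - (int a + 1) = int \<mu> - int a" "int (a + 1) = int a + 1" by simp_all
  have "res_minus (t_act \<kappa> (Suc \<mu>) v) a = qint (int (a + 1)) * v a
      + qq * qq powi (2 * int a + 1 - int \<mu>) * qint (int (Suc \<mu>) - int (a + 1)) * v (a + 1 + 1)
      + \<kappa> * (qq * qq powi (2 * int a - int \<mu>)) * v (a + 1)"
    using True unfolding p[symmetric] by (simp add: res_minus_def t_act_def del: of_nat_Suc of_nat_add)
  also have "\<dots> = (qq * qint (int a) + qq powi (- int a)) * v a
      + qq * qq powi (2 * int a + 1 - int \<mu>) * qint (int \<mu> - int a) * v (a + 1 + 1)
      + \<kappa> * (qq * qq powi (2 * int a - int \<mu>)) * v (a + 1)"
    by (simp only: i qint_Suc')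
  also have "\<dots> = qq * t_act \<kappa> \<mu> (res_minus v) a + res_plus \<mu> v a"
    using True by (cases "a = 0") (simp_all add: res_plus_def t_act_def res_minus_def algebra_simps)
  finally show ?thesis .
qed

lemma branch_comb_neg:
  assumes "\<And>j. j < 0 \<Longrightarrow> y j = 0" "\<And>j. j < 0 \<Longrightarrow> z j = 0" "k < 0"
  shows "branch_comb c e y z k = 0"
  using assms
  by (simp add: branch_comb_def)

lemma branch_comb_0:
  assumes "\<And>j. j < 0 \<Longrightarrow> y j = 0" "\<And>j. j < 0 \<Longrightarrow> z j = 0"
  shows "branch_comb c e y z 0 = y 0"
  using assms
  by (simp add: branch_comb_def)

text \<open>Applying t to the k-th vector and using its recursion determines the (k+1)-st, because
  [k+1] is nonzero for k >= 0. The two rows are proved together: t mixes the components, so the step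
  for either row uses both.\<close>

lemma act_idp_branching:
  fixes \<kappa> :: qf and \<mu> :: nat and e :: bool and v :: vec
  defines "y \<equiv> \<lambda>a k. act \<kappa> \<mu> (idp (\<not> e) k) (res_plus \<mu> v) a"
    and "z \<equiv> \<lambda>a k. act \<kappa> \<mu> (idp (\<not> e) k) (res_minus v) a"
  assumes v: "in_L (Suc \<mu>) v"
  shows "res_plus \<mu> (act \<kappa> (Suc \<mu>) (idp e k) v) = (\<lambda>a. branch_comb (inverse qq) e (y a) (z a) k)" (is "?P k")
    and "res_minus (act \<kappa> (Suc \<mu>) (idp e k) v) = (\<lambda>a. branch_comb qq e (z a) (y a) k)" (is "?Q k")
proof -
  let ?w = "\<lambda>k. act \<kappa> (Suc \<mu>) (idp e k) v"
  have yz0: "k < 0 \<Longrightarrow> y a k = 0" "k < 0 \<Longrightarrow> z a k = 0" for a k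
    by (simp_all add: y_def z_def)
  have neg: "?P k \<and> ?Q k" if "k < 0" for k
    using that by (simp add: branch_comb_neg yz0) (simp add: res_plus_def res_minus_def fun_eq_iff)
  have base: "?P 0 \<and> ?Q 0"
    by (simp add: branch_comb_0 yz0) (simp add: y_def z_def)
  have w: "in_L (Suc \<mu>) (?w k)" for k
    using v by (rule in_L_act)
  have rec: "t_act \<kappa> (Suc \<mu>) (?w k) a = qint (k + 1) * ?w (k + 1) a
      + (if has_lower_term e k then qint k * ?w (k - 1) a else 0)" for k a
    by (rule act_idp_rec)
  have step: "?P (k + 1) \<and> ?Q (k + 1)"
    if k: "k \<ge> 0" and IH: "?P k" "?Q k" "?P (k - 1)" "?Q (k - 1)" for k
  proof -
    have nz: "qint (k + 1) \<noteq> 0" using k by (intro qint_nonzero) simp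
    have "qint (k + 1) * res_plus \<mu> (?w (k + 1)) a
        = qint (k + 1) * branch_comb (inverse qq) e (y a) (z a) (k + 1)" for a
    proof -
      have "qint (k + 1) * res_plus \<mu> (?w (k + 1)) a
          + (if has_lower_term e k then qint k * res_plus \<mu> (?w (k - 1)) a else 0)
          = res_plus \<mu> (t_act \<kappa> (Suc \<mu>) (?w k)) a"
        by (simp add: res_plus_def rec algebra_simps)
      also have "\<dots> = inverse qq * t_act \<kappa> \<mu> (res_plus \<mu> (?w k)) a + res_minus (?w k) a"
        by (rule res_plus_t_act[OF w])
      also have "\<dots> = inverse qq * branch_comb (inverse qq) e
          (\<lambda>k. t_act \<kappa> \<mu> (\<lambda>a. y a k) a) (\<lambda>k. t_act \<kappa> \<mu> (\<lambda>a. z a k) a) k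
          + branch_comb (inverse (inverse qq)) e (z a) (y a) k"
        unfolding IH by (simp add: t_act_branch_comb[where Y = "\<lambda>k a. y a k" and Z = "\<lambda>k a. z a k"])
      also have "\<dots> = qint (k + 1) * branch_comb (inverse qq) e (y a) (z a) (k + 1)
          + (if has_lower_term e k then qint k * branch_comb (inverse qq) e (y a) (z a) (k - 1) else 0)"
        by (rule branch_comb_rec) (simp, simp add: inverse_qq_powi qint_Suc,
            unfold y_def z_def, (rule act_idp_rec)+)
      finally show ?thesis unfolding IH by simp
    qed
    moreover have "qint (k + 1) * res_minus (?w (k + 1)) a
        = qint (k + 1) * branch_comb qq e (z a) (y a) (k + 1)" for a
    proof -
      have "qint (k + 1) * res_minus (?w (k + 1)) a
          + (if has_lower_term e k then qint k * res_minus (?w (k - 1)) a else 0)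
          = res_minus (t_act \<kappa> (Suc \<mu>) (?w k)) a"
        by (simp add: res_minus_def rec algebra_simps)
      also have "\<dots> = qq * t_act \<kappa> \<mu> (res_minus (?w k)) a + res_plus \<mu> (?w k) a"
        by (rule res_minus_t_act[OF w])
      also have "\<dots> = qq * branch_comb qq e
          (\<lambda>k. t_act \<kappa> \<mu> (\<lambda>a. z a k) a) (\<lambda>k. t_act \<kappa> \<mu> (\<lambda>a. y a k) a) k
          + branch_comb (inverse qq) e (y a) (z a) k"
        unfolding IH by (simp add: t_act_branch_comb[where Y = "\<lambda>k a. z a k" and Z = "\<lambda>k a. y a k"])
      also have "\<dots> = qint (k + 1) * branch_comb qq e (z a) (y a) (k + 1)
          + (if has_lower_term e k then qint k * branch_comb qq e (z a) (y a) (k - 1) else 0)"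
        by (rule branch_comb_rec) (simp, simp add: qint_Suc', unfold y_def z_def, (rule act_idp_rec)+)
      finally show ?thesis unfolding IH by simp
    qed
    ultimately show ?thesis using nz by (simp add: fun_eq_iff)
  qed
  \<comment> \<open>The recursion has three terms, so two consecutive indices are carried along,
    starting with -1 and 0.\<close>
  have "(?P (int n) \<and> ?Q (int n)) \<and> (?P (int n - 1) \<and> ?Q (int n - 1))" for n
  proof (induction n)
    case 0
    show ?case using base neg[of "- 1"] by simp
  next
    case (Suc n)
    then show ?case using step[of "int n"] by (simp add: add.commute)
  qed
  from this[of "nat k"] have "?P k \<and> ?Q k"
    using neg[of k] by (cases "k < 0") simp_all
  then show "?P k" "?Q k" by auto
qed

section \<open>Values of the divided powers at quantum integers\<close>

lemma poly_idp_rec: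
  "s * poly (idp e k) s = qint (k + 1) * poly (idp e (k + 1)) s
     + (if has_lower_term e k then qint k * poly (idp e (k - 1)) s else 0)"
  using arg_cong[OF idp_rec[of e k], of "\<lambda>p. poly p s"] by (simp split: if_splits)

text \<open>A step of one in N switches the parity of the divided powers. Values at any [N] of
  matching parity, in particular at kappa = [2l] for even weights, can therefore be reached from t =
  [0] = 0.\<close>

lemma poly_idp_qint_Suc:
  fixes N :: int and e :: bool
  defines "y \<equiv> \<lambda>k. poly (idp (\<not> e) k) (qint N)"
  shows "poly (idp e k) (qint (N + 1)) = branch_comb (inverse qq) e y (\<lambda>k. qq powi N * y k) k" (is "?P k")
proof -
  let ?z = "\<lambda>k. qq powi N * y k"
  let ?m = "branch_comb (inverse qq) e y ?z"
  have y0: "k < 0 \<Longrightarrow> y k = 0" for k by (simp add: y_def)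
  have yrec: "qint N * y k = qint (k + 1) * y (k + 1)
      + (if has_lower_term (\<not> e) k then qint k * y (k - 1) else 0)" for k
    unfolding y_def by (rule poly_idp_rec)
  have neg: "?P k" if "k < 0" for k
    using that by (simp add: branch_comb_neg y0)
  have base: "?P 0"
    by (simp add: branch_comb_0 y0) (simp add: y_def)
  \<comment> \<open>For t = [N], the vector (1, q^N) is an eigenvector of the branching matrix, with
    eigenvalue [N+1].\<close>
  have eig: "branch_comb qq e ?z y k = qq powi N * ?m k" for k
  proof -
    define r where "r = (if has_lower_term e k then y (k - 2) else 0)"
    define N' K J where "N' = qq powi N" and "K = qq powi k" and "J = qq powi (k - 1)"
    have "N' \<noteq> 0" by (simp add: N'_def)
    have *: "(qq - inverse qq) * qint j = qq powi j - inverse (qq powi j)" for j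
      by (simp add: qint_def power_int_minus)
    have "qint N * y (k - 1) = qint k * y k + qint (k - 1) * r"
      using yrec[of "k - 1"] by (simp add: r_def)
    \<comment> \<open>Multiplication by q - q^(-1) turns each [j] into q^j - q^(-j). After a further
      factor q^N the recursion for \<open>y\<close> is, up to rearrangement, the eigenvector
      equation.\<close>
    from arg_cong[OF this, of "(*) (qq - inverse qq)"]
    have "(N' - inverse N') * y (k - 1) = (K - inverse K) * y k + (J - inverse J) * r"
      by (simp only: distrib_left mult.assoc[symmetric] * N'_def K_def J_def)
    from arg_cong[OF this, of "(*) N'"]
    have "K * (N' * y k) + J * (N' * r) + y (k - 1) = N' * (inverse K * y k + inverse J * r + N' * y (k - 1))"
      using \<open>N' \<noteq> 0\<close> by (simp add: algebra_simps)
    moreover have "branch_comb qq e ?z y k = K * (N' * y k) + J * (N' * r) + y (k - 1)"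
      by (simp add: branch_comb_def r_def N'_def K_def J_def)
    moreover have "?m k = inverse K * y k + inverse J * r + N' * y (k - 1)"
      by (simp add: branch_comb_def r_def N'_def K_def J_def power_int_inverse)
    ultimately show ?thesis by (simp add: N'_def)
  qed
  have mrec: "qint (N + 1) * ?m k = qint (k + 1) * ?m (k + 1)
      + (if has_lower_term e k then qint k * ?m (k - 1) else 0)" for k
  proof -
    \<comment> \<open>The scalar [N] takes the role of t here, so that the row recursion applies to
      numbers.\<close>
    have "inverse qq * branch_comb (inverse qq) e (\<lambda>k. qint N * y k) (\<lambda>k. qint N * ?z k) k
        + branch_comb (inverse (inverse qq)) e ?z y k
      = qint (k + 1) * ?m (k + 1) + (if has_lower_term e k then qint k * ?m (k - 1) else 0)"
    proof (rule branch_comb_rec)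
      show "qint N * ?z k = qint (k + 1) * ?z (k + 1)
          + (if has_lower_term (\<not> e) k then qint k * ?z (k - 1) else 0)" for k
        using arg_cong[OF yrec[of k], of "\<lambda>x. qq powi N * x"]
        by (simp add: algebra_simps split: if_splits)
    qed (simp_all only: yrec, simp_all add: inverse_qq_powi qint_Suc)
    moreover have "branch_comb (inverse qq) e (\<lambda>k. qint N * y k) (\<lambda>k. qint N * ?z k) k = qint N * ?m k"
      by (simp add: branch_comb_def algebra_simps)
    moreover have "qint (N + 1) * ?m k = inverse qq * (qint N * ?m k) + qq powi N * ?m k"
      by (simp only: qint_Suc[of N] distrib_right mult.assoc)
    ultimately show ?thesis by (simp only: eig inverse_inverse_eq)
  qed
  have step: "?P (k + 1)" if k: "k \<ge> 0" and IH: "?P k" "?P (k - 1)" for k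
  proof -
    have nz: "qint (k + 1) \<noteq> 0" using k by (intro qint_nonzero) simp
    have "qint (k + 1) * poly (idp e (k + 1)) (qint (N + 1)) = qint (k + 1) * ?m (k + 1)"
      using poly_idp_rec[of "qint (N + 1)" e k] mrec[of k] unfolding IH by (metis add_right_imp_eq)
    then show ?thesis using nz by simp
  qed
  have "?P (int n) \<and> ?P (int n - 1)" for n
  proof (induction n)
    case 0
    show ?case using base neg[of "- 1"] by simp
  next
    case (Suc n)
    then show ?case using step[of "int n"] by (simp add: add.commute)
  qed
  from this[of "nat k"] show "?P k"
    using neg[of k] by (cases "k < 0") simp_all
qed

lemma in_A_branch_comb:
  assumes "\<And>k. in_A (y k)" "\<And>k. in_A (z k)"
  shows "in_A (branch_comb qq e y z k)" "in_A (branch_comb (inverse qq) e y z k)"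
  unfolding branch_comb_def inverse_qq_powi using assms by (auto intro!: in_A_add in_A_mult)

text \<open>For even weights y_k is divisible by t when k > 0. The constant y_0 could enter only as
  the lower term in the formula for y_2, and there d_1 = 0.\<close>

lemma poly_idp_False_0: "poly (idp False k) 0 = (if k = 0 then 1 else 0)"
proof (cases "k \<le> 0")
  case True
  then show ?thesis by auto
next
  case False
  have "poly (idp_nat False (Suc n)) 0 = 0" for n
  proof (induction n rule: less_induct)
    case (less n)
    consider "n = 0" | "n = 1" | m where "n = Suc (Suc m)"
      by (metis One_nat_def not0_implies_Suc)
    then show ?case unfolding idp_nat.simps(2)[of _ n]
      by cases (use less in \<open>auto simp: has_lower_term_def simp del: idp_nat.simps(2)\<close>)
  qed
  from this[of "nat k - 1"] False show ?thesis by (simp add: idp_def)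
qed

text \<open>Going down from N to N-1, the preceding lemma is solved for its term with the highest index.\<close>
lemma in_A_poly_idp_qint: "in_A (poly (idp (odd N) k) (qint N))"
proof (induction N arbitrary: k rule: int_induct[where k = 0])
  case base
  show ?case by (simp add: poly_idp_False_0)
next
  case (step1 N)
  have IH: "in_A (poly (idp (\<not> odd (N + 1)) k) (qint N))" for k
    using step1.IH[of k] by simp
  show ?case
    by (subst poly_idp_qint_Suc) (intro in_A_branch_comb in_A_mult IH in_A_qq_powi)
next
  case (step2 N)
  define y where "y k = poly (idp (odd (N - 1)) k) (qint (N - 1))" for k
  have "odd (N - 1) = (\<not> odd N)" by simp
  then have *: "poly (idp (odd N) k) (qint N) = branch_comb (inverse qq) (odd N) y (\<lambda>k. qq powi (N - 1) * y k) k"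
    for k
    using poly_idp_qint_Suc[of "odd N" k "N - 1"] unfolding y_def by simp
  have neg: "k < 0 \<Longrightarrow> in_A (y k)" for k by (simp add: y_def)
  have "in_A (y (int n))" for n
  proof (induction n rule: less_induct)
    case (less n)
    have IH: "in_A (y j)" if "j < int n" for j
      using that less[of "nat j"] neg[of j] by (cases "j < 0") auto
    let ?r = "(if has_lower_term (odd N) (int n) then inverse qq powi (int n - 1) * y (int n - 2) else 0)
        + qq powi (N - 1) * y (int n - 1)"
    \<comment> \<open>In the formula for N the term \<open>y (int n)\<close> has the coefficient
      q^(-n), a unit of A, and all other terms have smaller index.\<close>
    have "y (int n) = qq powi (int n) * (poly (idp (odd N) (int n)) (qint N) - ?r)"
      unfolding * branch_comb_def inverse_qq_powi power_int_minus by simp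
    moreover have "in_A ?r"
      by (auto intro!: in_A_add in_A_mult IH simp: inverse_qq_powi)
    ultimately show ?case
      using step2.IH by (simp only:) (intro in_A_mult in_A_diff in_A_qq_powi)
  qed
  from this[of "nat k"] show ?case using neg[of k] unfolding y_def
    by (cases "k < 0") simp_all
qed

text \<open>Each branching step lowers mu by one and switches the parity. The induction ends at L(0)
  with the even-weight polynomials evaluated at kappa = [2l], which is where the form of kappa
  enters.\<close>

lemma in_A_act_idp:
  assumes "in_L \<mu> v" "\<And>a. in_A (v a)"
  shows "in_A (act (qint (2 * l)) \<mu> (idp (odd \<mu>) k) v a)"
  using assms
proof (induction \<mu> arbitrary: v k a)
  case 0
  show ?case
  proof (cases "a = 0")
    case True
    then show ?thesis using 0 in_A_poly_idp_qint[of "2 * l" k]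
      by (simp add: act_L0 in_A_mult)
  next
    case False
    then show ?thesis using in_L_act[OF 0(1)] by (simp add: in_L_def)
  qed
next
  case (Suc \<mu>)
  let ?w = "act (qint (2 * l)) (Suc \<mu>) (idp (odd (Suc \<mu>)) k) v"
  have "in_A (res_plus \<mu> v a)" "in_A (res_minus v a)" for a
    using Suc.prems(2) by (auto simp: res_plus_def res_minus_def intro: in_A_mult)
  then have IH: "in_A (act (qint (2 * l)) \<mu> (idp (\<not> odd (Suc \<mu>)) k) (res_plus \<mu> v) a)"
      "in_A (act (qint (2 * l)) \<mu> (idp (\<not> odd (Suc \<mu>)) k) (res_minus v) a)" for k a
    using Suc.IH in_L_res_plus in_L_res_minus[OF Suc.prems(1)] by auto
  \<comment> \<open>The two components recover the vector over A: \<open>res_plus\<close> at 0 has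
    the factor q^0 and gives entry 0, and \<open>res_minus\<close> gives all later entries.\<close>
  have "in_A (res_plus \<mu> ?w 0)" "in_A (res_minus ?w b)" for b
    unfolding act_idp_branching[OF Suc.prems(1)] by (intro in_A_branch_comb IH)+
  then have "in_A (?w 0)" "in_A (?w (b + 1))" for b
    by (simp_all add: res_plus_def res_minus_def)
  then show ?case by (cases a) (simp_all only: Suc_eq_plus1)
qed

section \<open>Divided powers on the highest weight vector\<close>

text \<open>The recursion involves only quantum integers and their inverses, which are bar
  invariant.\<close>

lemma qbar_coeff_idp_nat: "qbar (coeff (idp_nat e n) i) = coeff (idp_nat e n) i"
proof (induction n arbitrary: i rule: less_induct)
  case (less n)
  show ?case
  proof (cases n)
    case 0
    then show ?thesis by (cases i) (auto simp: one_pCons coeff_pCons)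
  next
    case (Suc m)
    then have IH: "qbar (coeff (idp_nat e m) j) = coeff (idp_nat e m) j"
      "qbar (coeff (idp_nat e (m - 1)) j) = coeff (idp_nat e (m - 1)) j" for j
      using less by auto
    show ?thesis unfolding Suc
      by (cases i) (simp_all add: coeff_pCons qbar_mult qbar_diff qbar_minus qbar_inverse qbar_qint IH[simplified])
  qed
qed

lemma Upsi_idp: "Upsi (idp e k) = idp e k"
  by (rule poly_eqI) (simp add: Upsi_def coeff_map_poly idp_def qbar_coeff_idp_nat)

lemma degree_idp_nat: "degree (idp_nat e n) \<le> n"
  and coeff_idp_nat_nonzero: "coeff (idp_nat e n) n \<noteq> 0"
proof -
  have "degree (idp_nat e n) \<le> n \<and> coeff (idp_nat e n) n \<noteq> 0"
  proof (induction n rule: less_induct)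
    case (less n)
    show ?case
    proof (cases n)
      case (Suc m)
      have IH: "degree (idp_nat e m) \<le> m" "degree (idp_nat e (m - 1)) \<le> m - 1"
          "coeff (idp_nat e m) m \<noteq> 0"
        using less[of m] less[of "m - 1"] Suc by auto
      have "degree (idp_nat e (Suc m)) \<le> Suc m"
        using IH
        by (auto intro!: order.trans[OF degree_smult_le] degree_diff_le order.trans[OF degree_pCons_le]
            simp del: degree_smult_eq)
      moreover have "coeff (idp_nat e (Suc m)) (Suc m) \<noteq> 0"
        using IH qint_nonzero[of "int m + 1"] by (simp add: coeff_eq_0)
      ultimately show ?thesis unfolding Suc by blast
    qed simp
  qed
  then show "degree (idp_nat e n) \<le> n" "coeff (idp_nat e n) n \<noteq> 0" by auto
qed

section \<open>The product formula for the divided powers\<close>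

lemma tdot_prod_Suc:
  "(\<Prod>j\<in>{- int (Suc a) + 1..int (Suc a)}. [:- qint (2 * j - 1), 1:]) =
   pCons 0 (pCons 0 (\<Prod>j\<in>{- int a + 1..int a}. [:- qint (2 * j - 1), 1:]))
   - smult (qint (2 * int a + 1) ^ 2) (\<Prod>j\<in>{- int a + 1..int a}. [:- qint (2 * j - 1), 1:])"
proof -
  let ?f = "\<lambda>j. [:- qint (2 * j - 1), 1:]"
  let ?P = "\<Prod>j\<in>{- int a + 1..int a}. ?f j"
  \<comment> \<open>The two new factors, for j = -a and j = a + 1, have the roots -[2a+1] and
    [2a+1]; together they give t^2 - [2a+1]^2.\<close>
  have "{- int (Suc a) + 1..int (Suc a)} = insert (- int a) (insert (int a + 1) {- int a + 1..int a})"
    by auto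
  then have "(\<Prod>j\<in>{- int (Suc a) + 1..int (Suc a)}. ?f j) = ?f (- int a) * (?f (int a + 1) * ?P)"
    by simp
  moreover have "qint (- (2 * int a) - 1) = - qint (2 * int a + 1)"
    using qint_minus[of "2 * int a + 1"] by simp
  ultimately have "(\<Prod>j\<in>{- int (Suc a) + 1..int (Suc a)}. ?f j)
      = [:qint (2 * int a + 1), 1:] * ([:- qint (2 * int a + 1), 1:] * ?P)"
    by (simp add: distrib_left add.commute[of 1] del: mult_pCons_left)
  also have "\<dots> = [:- (qint (2 * int a + 1) ^ 2), 0, 1:] * ?P"
    by (simp only: mult.assoc[symmetric]) (simp add: power2_eq_square del: mult.assoc)
  finally show ?thesis by simp
qed

text \<open>Two steps of the odd-weight recursion are taken at once. Passing from an even to an odd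
  index only multiplies by t; passing on to the next even index subtracts the lower term and
  produces t^2 - [2a+1]^2.\<close>

lemma tdot_eq_idp: "tdot n = idp True (int n)"
proof -
  let ?P = "\<lambda>a. \<Prod>j\<in>{- int a + 1..int a}. [:- qint (2 * j - 1), 1:]"
  have qfact_Suc: "qfact (Suc n) = qfact n * qint (int n + 1)" for n
    by (simp add: qfact_def add.commute)
  have "idp_nat True (2 * a) = smult (inverse (qfact (2 * a))) (?P a) \<and>
        idp_nat True (2 * a + 1) = smult (inverse (qfact (2 * a + 1))) (pCons 0 (?P a))" for a
  proof (induction a)
    case 0
    show ?case by (simp add: qfact_def has_lower_term_def)
  next
    case (Suc a)
    have nz: "qint (2 * int a + 1) \<noteq> 0" by (rule qint_nonzero) simp
    \<comment> \<open>With x_(2a) = p/f and x_(2a+1) = t p/(f x), this extracts the common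
      denominator f x z, where x = [2a+1] and z = [2a+2].\<close>
    have *: "smult (inverse z) (pCons 0 (smult (inverse (f * x)) (pCons 0 p)) - smult x (smult (inverse f) p))
        = smult (inverse (f * x * z)) (pCons 0 (pCons 0 p) - smult (x ^ 2) p)"
      if "x \<noteq> 0" for f x z :: qf and p
      using that by (cases "f = 0"; cases "z = 0"; intro poly_eqI)
        (simp_all add: coeff_pCons power2_eq_square field_simps split: nat.split)
    have "idp_nat True (2 * a + 2) = smult (inverse (qint (2 * int a + 2)))
        (pCons 0 (idp_nat True (2 * a + 1)) - smult (qint (2 * int a + 1)) (idp_nat True (2 * a)))"
      by (simp add: has_lower_term_def numeral_2_eq_2 algebra_simps)
    also have "\<dots> = smult (inverse (qfact (2 * a + 2))) (?P (Suc a))"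
      unfolding tdot_prod_Suc Suc.IH[THEN conjunct1] Suc.IH[THEN conjunct2]
      using qfact_Suc[of "2 * a"] qfact_Suc[of "2 * a + 1"] *[OF nz]
      by (simp add: add.commute[of 2])
    finally have e: "idp_nat True (2 * a + 2) = smult (inverse (qfact (2 * a + 2))) (?P (Suc a))" .
    have "idp_nat True (2 * a + 3) = smult (inverse (qint (2 * int a + 3))) (pCons 0 (idp_nat True (2 * a + 2)))"
      by (simp add: has_lower_term_def numeral_3_eq_3 numeral_2_eq_2 algebra_simps)
    also have "\<dots> = smult (inverse (qfact (2 * a + 3))) (pCons 0 (?P (Suc a)))"
      unfolding e using qfact_Suc[of "2 * a + 2"] by (simp add: numeral_3_eq_3 algebra_simps)
    finally show ?case using e by (simp add: numeral_3_eq_3)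
  qed
  then show ?thesis
    by (cases "even n")
      (auto simp: idp_def tdot_def simp del: idp_nat.simps(2) elim!: evenE oddE)
qed

section \<open>Coefficients of the divided powers applied to v^+\<close>

lemma in_L_hwv: "in_L \<mu> hwv"
  by (simp add: in_L_def hwv_def)

lemma res_plus_hwv: "res_plus \<mu> hwv = hwv"
  by (auto simp: res_plus_def hwv_def)

lemma res_minus_hwv: "res_minus hwv = (\<lambda>_. 0)"
  by (auto simp: res_minus_def hwv_def)

text \<open>This is c(mu, k); the parity of mu selects the odd-weight or the even-weight divided
  power.\<close>

definition idp_hwv_coeff :: "qf \<Rightarrow> nat \<Rightarrow> int \<Rightarrow> qf" where
  "idp_hwv_coeff \<kappa> \<mu> k = act \<kappa> \<mu> (idp (odd \<mu>) k) hwv 0"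

text \<open>The embedding sends v^+ to a pair with vanishing second component, so the second row
  contributes only its off-diagonal entry, the divided power of index k-1.\<close>

lemma act_idp_hwv_Suc:
  "act \<kappa> (Suc \<mu>) (idp (odd (Suc \<mu>)) k) hwv (Suc b) = act \<kappa> \<mu> (idp (odd \<mu>) (k - 1)) hwv b"
proof -
  have "(\<not> odd (Suc \<mu>)) = odd \<mu>" by simp
  then show ?thesis
    using fun_cong[OF act_idp_branching(2)[OF in_L_hwv,
          where \<mu> = \<mu> and \<kappa> = \<kappa> and e = "odd (Suc \<mu>)" and k = k], of b]
    unfolding res_plus_hwv res_minus_hwv by (simp add: branch_comb_def act_zero_vec res_minus_def)
qed

text \<open>For the same reason the first row contributes only its diagonal entry, read off here at
  the coefficient of v^+.\<close>

lemma idp_hwv_coeff_Suc: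
  "idp_hwv_coeff \<kappa> (Suc \<mu>) k = qq powi (- k) * idp_hwv_coeff \<kappa> \<mu> k
     + (if has_lower_term (odd (Suc \<mu>)) k then qq powi (1 - k) * idp_hwv_coeff \<kappa> \<mu> (k - 2) else 0)"
proof -
  have "(\<not> odd (Suc \<mu>)) = odd \<mu>" by simp
  then show ?thesis
    using fun_cong[OF act_idp_branching(1)[OF in_L_hwv,
          where \<mu> = \<mu> and \<kappa> = \<kappa> and e = "odd (Suc \<mu>)" and k = k], of 0]
    unfolding res_plus_hwv res_minus_hwv
    by (simp add: branch_comb_def act_zero_vec res_plus_def idp_hwv_coeff_def inverse_qq_powi)
qed

lemma act_idp_hwv:
  "r \<le> \<mu> \<Longrightarrow> act \<kappa> \<mu> (idp (odd \<mu>) k) hwv r = idp_hwv_coeff \<kappa> (\<mu> - r) (k - int r)"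
proof (induction r arbitrary: \<mu> k)
  case 0
  show ?case by (simp add: idp_hwv_coeff_def)
next
  case (Suc r)
  then obtain \<nu> where "\<mu> = Suc \<nu>" "r \<le> \<nu>" by (cases \<mu>) auto
  then show ?case using Suc.IH[of \<nu> "k - 1"] act_idp_hwv_Suc[of \<kappa> \<nu> k r]
    by (simp add: algebra_simps)
qed

lemma idp_hwv_coeff_0: "idp_hwv_coeff \<kappa> \<mu> 0 = 1"
  by (simp add: idp_hwv_coeff_def hwv_def)

lemma idp_hwv_coeff_neg: "k < 0 \<Longrightarrow> idp_hwv_coeff \<kappa> \<mu> k = 0"
  by (simp add: idp_hwv_coeff_def)

lemma in_A_idp_hwv_coeff: "in_A (idp_hwv_coeff (qint (2 * l)) \<mu> k)"
  unfolding idp_hwv_coeff_def by (rule in_A_act_idp[OF in_L_hwv]) (simp add: hwv_def)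

section \<open>Coefficients for large highest weight\<close>

lemma recurrence_eventually_in_qinvZ:
  assumes n: "n > 0" and A: "\<And>m. in_A (u m)"
    and rec: "\<And>m. u (Suc m) = inverse qq ^ n * u m + w m"
    and w: "\<And>m. m \<ge> M \<Longrightarrow> in_qinvZ (w m)"
  shows "\<exists>M'. \<forall>m\<ge>M'. in_qinvZ (u m)"
proof -
  \<comment> \<open>Unrolling from M on, the terms \<open>w\<close> accumulate inside q^(-1)
    Z[q^(-1)], and the starting value \<open>u M\<close> acquires the factor q^(-ni).\<close>
  have *: "\<exists>s. in_qinvZ s \<and> u (M + i) = inverse qq ^ (n * i) * u M + s" for i
  proof (induction i)
    case 0
    show ?case by (intro exI[of _ 0]) simp
  next
    case (Suc i)
    then obtain s where s: "in_qinvZ s" "u (M + i) = inverse qq ^ (n * i) * u M + s" by blast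
    have "u (M + Suc i) = inverse qq ^ (n * Suc i) * u M + (inverse qq ^ n * s + w (M + i))"
      by (simp only: add_Suc_right rec s(2) mult_Suc_right power_add) (simp add: algebra_simps)
    moreover have "in_qinvZ (inverse qq ^ n * s + w (M + i))"
      using s(1) w by (intro in_qinvZ_add in_qinvZ_mult_power) auto
    ultimately show ?case by blast
  qed
  obtain N where N: "in_qinvZ (inverse qq ^ N * u M)"
    using in_A_imp_eventually_in_qinvZ[OF A] by blast
  have "in_qinvZ (u m)" if "m \<ge> M + N" for m
  proof -
    define i where "i = m - M"
    have m: "m = M + i" "i \<ge> N" using that by (auto simp: i_def)
    \<comment> \<open>Since n >= 1, the exponent n i is at least N, enough to absorb
      \<open>u M\<close>.\<close>
    then have "n * i = (n * i - N) + N" using n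
      by (metis One_nat_def Suc_leI add.commute le_add_diff_inverse le_trans mult_le_mono1 nat_mult_1)
    then have "inverse qq ^ (n * i) * u M = inverse qq ^ (n * i - N) * (inverse qq ^ N * u M)"
      by (metis mult.assoc power_add)
    then have "in_qinvZ (inverse qq ^ (n * i) * u M)"
      using in_qinvZ_mult_power[OF N] by (simp only:)
    then show ?thesis using *[of i] m by (auto intro: in_qinvZ_add)
  qed
  then show ?thesis by blast
qed

text \<open>Induction in steps of two: the inhomogeneous term of the recursion for c(mu, n) is a
  power of q^(-1) times c(mu, n-2).\<close>

lemma idp_hwv_coeff_eventually_in_qinvZ:
  "n > 0 \<Longrightarrow> \<exists>M. \<forall>\<mu>\<ge>M. in_qinvZ (idp_hwv_coeff (qint (2 * l)) \<mu> (int n))"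
proof (induction n rule: less_induct)
  case (less n)
  let ?c = "idp_hwv_coeff (qint (2 * l))"
  let ?w = "\<lambda>\<mu>. if has_lower_term (odd (Suc \<mu>)) (int n) then qq powi (1 - int n) * ?c \<mu> (int n - 2) else 0"
  have rec: "?c (Suc \<mu>) (int n) = inverse qq ^ n * ?c \<mu> (int n) + ?w \<mu>" for \<mu>
    by (simp add: idp_hwv_coeff_Suc power_int_minus power_inverse)
  have "\<exists>M. \<forall>\<mu>\<ge>M. in_qinvZ (?w \<mu>)"
  proof -
    consider "n = 1" | "n = 2" | "n > 2" using less.prems by linarith
    then show ?thesis
    proof cases
      case 1
      then show ?thesis by (simp add: idp_hwv_coeff_neg)
    next
      \<comment> \<open>Here c(mu, 0) = 1 is not in q^(-1) Z[q^(-1)], so the prefactor q^(1-n) =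
        q^(-1) has to supply membership.\<close>
      case 2
      have "in_qinvZ (inverse qq)"
        unfolding in_qinvZ_iff
        by (intro exI[of _ 1] conjI) (use of_int_poly_q_monom[of 0] in auto)
      with 2 show ?thesis by (auto simp: idp_hwv_coeff_0 power_int_minus)
    next
      case 3
      then have "int (n - 2) = int n - 2" by simp
      then obtain M where M: "\<And>\<mu>. \<mu> \<ge> M \<Longrightarrow> in_qinvZ (?c \<mu> (int n - 2))"
        using less.IH[of "n - 2"] 3 by auto
      have "1 - int n = - int (n - 1)" using 3 by simp
      then have "qq powi (1 - int n) = inverse qq ^ (n - 1)"
        by (simp only: power_int_minus power_int_of_nat power_inverse)
      with M show ?thesis
        by (intro exI[of _ M]) (auto intro: in_qinvZ_mult_power)
    qed
  qed
  then obtain M where "\<And>\<mu>. \<mu> \<ge> M \<Longrightarrow> in_qinvZ (?w \<mu>)" by blast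
  then show ?case
    by (intro recurrence_eventually_in_qinvZ[where w = ?w, OF less.prems in_A_idp_hwv_coeff rec])
qed

lemma act_tdot_hwv:
  assumes "r \<le> 2 * m + 1"
  shows "act \<kappa> (2 * m + 1) (tdot n) hwv r = idp_hwv_coeff \<kappa> (2 * m + 1 - r) (int n - int r)"
  using act_idp_hwv[OF assms, of \<kappa> "int n"] by (simp add: tdot_eq_idp)

lemma tdot_icb_elem:
  "\<exists>M. \<forall>m\<ge>M. icb_elem (qint (2 * l)) (2 * m + 1) n (act (qint (2 * l)) (2 * m + 1) (tdot n) hwv)"
proof -
  let ?\<kappa> = "qint (2 * l)"
  have "\<forall>j. \<exists>M. j > 0 \<longrightarrow> (\<forall>\<mu>\<ge>M. in_qinvZ (idp_hwv_coeff ?\<kappa> \<mu> (int j)))"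
    using idp_hwv_coeff_eventually_in_qinvZ by blast
  then obtain f where f: "\<And>j \<mu>. j > 0 \<Longrightarrow> \<mu> \<ge> f j \<Longrightarrow> in_qinvZ (idp_hwv_coeff ?\<kappa> \<mu> (int j))"
    by metis
  \<comment> \<open>One bound must serve all r < n, each of which needs 2m+1-r >=
    \<open>f (n - r)\<close>. The sum dominates every \<open>f (n - r)\<close>, and the summand n
    absorbs the shift by r.\<close>
  define M where "M = n + (\<Sum>j\<le>n. f j)"
  have "icb_elem ?\<kappa> (2 * m + 1) n (act ?\<kappa> (2 * m + 1) (tdot n) hwv)" if "m \<ge> M" for m
  proof -
    let ?v = "act ?\<kappa> (2 * m + 1) (tdot n) hwv"
    have n: "n \<le> 2 * m + 1" using that by (simp add: M_def)
    have L: "in_L (2 * m + 1) ?v" by (intro in_L_act in_L_hwv)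
    have "Upsi (tdot n) = tdot n" by (simp add: tdot_eq_idp Upsi_idp)
    \<comment> \<open>The witness is \<open>tdot n\<close> itself, being fixed by
      \<open>Upsi\<close>.\<close>
    then have bar: "\<exists>x. act ?\<kappa> (2 * m + 1) x hwv = ?v \<and> act ?\<kappa> (2 * m + 1) (Upsi x) hwv = ?v"
      by metis
    have "?v n = 1" unfolding act_tdot_hwv[OF n] by (simp add: idp_hwv_coeff_0)
    moreover have "in_qinvZ (?v r)" if r: "r < n" for r
    proof -
      have "f (n - r) \<le> (\<Sum>j\<le>n. f j)" by (rule member_le_sum) auto
      then have "f (n - r) \<le> 2 * m + 1 - r" using \<open>m \<ge> M\<close> r by (simp add: M_def)
      then have "in_qinvZ (idp_hwv_coeff ?\<kappa> (2 * m + 1 - r) (int (n - r)))"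
        using r by (intro f) auto
      then show ?thesis using act_tdot_hwv[of r m ?\<kappa> n] n r by (simp add: of_nat_diff)
    qed
    moreover have "?v r = 0" if "n < r" for r
      using that L act_tdot_hwv[of r m ?\<kappa> n]
      by (cases "r \<le> 2 * m + 1") (auto simp: in_L_def idp_hwv_coeff_neg)
    ultimately show ?thesis using n L bar by (simp add: icb_elem_def)
  qed
  then show ?thesis by blast
qed

lemma tdot_in_AUodd: "tdot n \<in> AUodd (qint (2 * l))"
  unfolding AUodd_def tdot_eq_idp
proof (intro CollectI allI impI)
  fix \<mu> v a
  assume "odd \<mu>" "in_L \<mu> v" "\<forall>a. in_A (v a)"
  then show "in_A (act (qint (2 * l)) \<mu> (idp True (int n)) v a)"
    using in_A_act_idp[of \<mu> v l "int n" a] by simp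
qed

section \<open>Expansion in the divided powers\<close>

lemma poly_eq_sum_tdot:
  "degree x < N \<Longrightarrow> \<exists>c. x = (\<Sum>n<N. smult (c n) (tdot n))"
proof (induction N arbitrary: x)
  case 0
  then show ?case by simp
next
  case (Suc N)
  have tdot: "degree (tdot N) \<le> N" "coeff (tdot N) N \<noteq> 0"
    using degree_idp_nat coeff_idp_nat_nonzero by (auto simp: tdot_eq_idp idp_def)
  define b where "b = coeff x N / coeff (tdot N) N"
  let ?y = "x - smult b (tdot N)"
  show ?case
  \<comment> \<open>Constants are treated separately: subtracting the leading term leaves 0, whose
    degree 0 violates the strict bound \<open>degree ?y < N\<close>.\<close>
  proof (cases "N = 0")
    case True
    then obtain a where "x = [:a:]" using Suc.prems degree_eq_zeroE by auto
    then show ?thesis using True by (intro exI[of _ "\<lambda>_. a"]) (simp add: tdot_eq_idp one_pCons)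
  next
    case False
    have "coeff ?y i = 0" if "i \<ge> N" for i
      using that tdot Suc.prems by (cases "i = N") (auto simp: b_def coeff_eq_0)
    then have "degree ?y < N"
      using False by (metis degree_0 gr0I leading_coeff_0_iff not_le)
    then obtain c where "?y = (\<Sum>n<N. smult (c n) (tdot n))" using Suc.IH by blast
    then have "x = (\<Sum>n<Suc N. smult ((c(N := b)) n) (tdot n))"
      by (simp add: algebra_simps)
    then show ?thesis by blast
  qed
qed

text \<open>Unitriangularity: \<open>tdot n\<close> applied to v^+ has no F^(k) v^+ term for n < k,
  and for n = k its coefficient is 1. The bound on N keeps all these basis vectors inside the
  module.\<close>

lemma act_sum_tdot_hwv:
  assumes "N \<le> 2 * m + 1" "k < N"
  shows "act \<kappa> (2 * m + 1) (\<Sum>n<N. smult (c n) (tdot n)) hwv k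
    = c k + (\<Sum>n\<in>{k<..<N}. c n * act \<kappa> (2 * m + 1) (tdot n) hwv k)"
proof -
  let ?g = "\<lambda>n. c n * act \<kappa> (2 * m + 1) (tdot n) hwv k"
  have k: "k \<le> 2 * m + 1" using assms by simp
  have "act \<kappa> (2 * m + 1) (\<Sum>n<N. smult (c n) (tdot n)) hwv k = (\<Sum>n<N. ?g n)"
    by (simp add: act_sum act_smult)
  also have "\<dots> = (\<Sum>n\<in>insert k {k<..<N}. ?g n)"
    unfolding act_tdot_hwv[OF k]
    using assms(2) by (intro sum.mono_neutral_right) (auto simp: idp_hwv_coeff_neg)
  also have "\<dots> = c k + (\<Sum>n\<in>{k<..<N}. ?g n)"
    unfolding act_tdot_hwv[OF k] by (simp add: idp_hwv_coeff_0)
  finally show ?thesis .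
qed

text \<open>The unitriangular system is solved downwards from the largest index. It has this shape
  for every kappa, and the value 0 is taken.\<close>

lemma sum_tdot_eq_0:
  assumes "(\<Sum>n<N. smult (c n) (tdot n)) = 0" "k < N"
  shows "c k = 0"
  using assms(2)
proof (induction "N - k" arbitrary: k rule: less_induct)
  case less
  have "(\<Sum>n\<in>{k<..<N}. c n * act 0 (2 * N + 1) (tdot n) hwv k) = 0"
    using less by (intro sum.neutral) auto
  then show ?case
    using act_sum_tdot_hwv[of N N k 0 c] less.prems assms(1) by simp
qed

text \<open>The same downward elimination works over A: the diagonal entries are 1, and the
  remaining entries are integral because each \<open>tdot n\<close> preserves the A-form of
  L(2N+1).\<close>

lemma in_A_coeffs_tdot:
  assumes "(\<Sum>n<N. smult (c n) (tdot n)) \<in> AUodd (qint (2 * l))" "k < N"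
  shows "in_A (c k)"
  using assms(2)
proof (induction "N - k" arbitrary: k rule: less_induct)
  case less
  have A: "in_A (act (qint (2 * l)) (2 * N + 1) x hwv k)" if "x \<in> AUodd (qint (2 * l))" for x
    using that in_L_hwv[of "2 * N + 1"] by (auto simp: AUodd_def hwv_def)
  have "in_A (\<Sum>n\<in>{k<..<N}. c n * act (qint (2 * l)) (2 * N + 1) (tdot n) hwv k)"
    using less by (intro in_A_sum in_A_mult A tdot_in_AUodd) auto
  moreover have "in_A (c k + (\<Sum>n\<in>{k<..<N}. c n * act (qint (2 * l)) (2 * N + 1) (tdot n) hwv k))"
    using A[OF assms(1)] act_sum_tdot_hwv[of N N k "qint (2 * l)" c] less.prems by simp
  ultimately show ?case using in_A_diff by fastforce
qed

theorem theorem3p9: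
  fixes l :: int and \<kappa> :: qf
  assumes "\<kappa> = qint (2 * l)"
  shows "(\<forall>n. \<exists>M. \<forall>m\<ge>M. \<exists>a.
            icb_elem \<kappa> (2 * m + 1) a (act \<kappa> (2 * m + 1) (tdot n) hwv))
       \<and> (\<forall>n. tdot n \<in> AUodd \<kappa> \<and>
            (\<exists>M. \<forall>m\<ge>M. icb_elem \<kappa> (2 * m + 1) n (act \<kappa> (2 * m + 1) (tdot n) hwv)))
       \<and> (\<forall>c :: nat \<Rightarrow> qf. finite {n. c n \<noteq> 0} \<longrightarrow> (\<forall>n. in_A (c n)) \<longrightarrow>
            (\<Sum>n\<in>{n. c n \<noteq> 0}. smult (c n) (tdot n)) = 0 \<longrightarrow> (\<forall>n. c n = 0))
       \<and> (\<forall>x\<in>AUodd \<kappa>. \<exists>c :: nat \<Rightarrow> qf. finite {n. c n \<noteq> 0} \<and> (\<forall>n. in_A (c n)) \<and>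
            x = (\<Sum>n\<in>{n. c n \<noteq> 0}. smult (c n) (tdot n)))"
proof (intro conjI allI impI ballI)
  show "\<exists>M. \<forall>m\<ge>M. \<exists>a. icb_elem \<kappa> (2 * m + 1) a (act \<kappa> (2 * m + 1) (tdot n) hwv)" for n
    using tdot_icb_elem[of l n] unfolding assms by blast
  show "tdot n \<in> AUodd \<kappa>" for n
    unfolding assms by (rule tdot_in_AUodd)
  show "\<exists>M. \<forall>m\<ge>M. icb_elem \<kappa> (2 * m + 1) n (act \<kappa> (2 * m + 1) (tdot n) hwv)" for n
    unfolding assms by (rule tdot_icb_elem)
next
  fix c :: "nat \<Rightarrow> qf" and k
  assume fin: "finite {n. c n \<noteq> 0}" and 0: "(\<Sum>n\<in>{n. c n \<noteq> 0}. smult (c n) (tdot n)) = 0"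
  from fin obtain N where N: "{n. c n \<noteq> 0} \<subseteq> {..<N}"
    using finite_nat_iff_bounded by blast
  then have "(\<Sum>n\<in>{n. c n \<noteq> 0}. smult (c n) (tdot n)) = (\<Sum>n<N. smult (c n) (tdot n))"
    by (intro sum.mono_neutral_left) auto
  with 0 have "k < N \<Longrightarrow> c k = 0" using sum_tdot_eq_0[of c N k] by simp
  then show "c k = 0" using N by blast
next
  fix x assume x: "x \<in> AUodd \<kappa>"
  define N where "N = Suc (degree x)"
  obtain c where c: "x = (\<Sum>n<N. smult (c n) (tdot n))"
    using poly_eq_sum_tdot[of x N] by (auto simp: N_def)
  \<comment> \<open>The expansion leaves \<open>c\<close> arbitrary from N on, so it is cut off
    there to have finite support and values in A.\<close>
  define d where "d n = (if n < N then c n else 0)" for n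
  have fin: "{n. d n \<noteq> 0} \<subseteq> {..<N}" by (auto simp: d_def)
  have "x = (\<Sum>n<N. smult (d n) (tdot n))" unfolding c by (simp add: d_def)
  also have "\<dots> = (\<Sum>n\<in>{n. d n \<noteq> 0}. smult (d n) (tdot n))"
    using fin by (intro sum.mono_neutral_right) auto
  finally have "x = (\<Sum>n\<in>{n. d n \<noteq> 0}. smult (d n) (tdot n))" .
  moreover have "in_A (d n)" for n
    using x in_A_coeffs_tdot[of c N l n] by (simp add: d_def assms c)
  moreover have "finite {n. d n \<noteq> 0}" using fin finite_subset by blast
  ultimately show "\<exists>c. finite {n. c n \<noteq> 0} \<and> (\<forall>n. in_A (c n)) \<and>
      x = (\<Sum>n\<in>{n. c n \<noteq> 0}. smult (c n) (tdot n))" by blast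
qed

end
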